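(* Let $\epsilon>0$, $c(\epsilon):=\epsilon/\sqrt5$, and $q\ge1$ an integer. If $w_A,w_B:\mathbb{Z}/q\mathbb{Z}\to[0,1]$ satisfy $\sum_{t\in\mathbb{Z}/q\mathbb{Z}}w_A(t)\ge(\tfrac38+\epsilon)q$ and $\sum_{t\in\mathbb{Z}/q\mathbb{Z}}w_B(t)\ge(\tfrac38+\epsilon)q$, then $$\sum_{t\in\mathbb{Z}/q\mathbb{Z}}(w_A*w_B)(t)\,f_q(t)\ \ge\ c(\epsilon)\,q.$$
   Context: For $f,g:\mathbb{Z}/q\mathbb{Z}\to\mathbb{C}$, the convolution is $(f*g)(x):=\frac1q\sum_{a\in\mathbb{Z}/q\mathbb{Z}}f(a)g(x-a)$. The function $f_q:\mathbb{Z}/q\mathbb{Z}\to\mathbb{R}$ is $f_q(t):=\#\{x\in\mathbb{Z}/q\mathbb{Z}:x^2=t\}$. *)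

theory Defs
  imports Complex_Main
begin

text \<open>Z/qZ is represented by the residues {0..<q} (q \<ge> 1), with arithmetic mod q.\<close>

definition zconv :: "nat \<Rightarrow> (nat \<Rightarrow> real) \<Rightarrow> (nat \<Rightarrow> real) \<Rightarrow> nat \<Rightarrow> real" where
  "zconv q f g x = (1 / real q) * (\<Sum>a<q. f a * g ((x + q - a) mod q))"

definition fq :: "nat \<Rightarrow> nat \<Rightarrow> real" where
  "fq q t = real (card {x \<in> {..<q}. x^2 mod q = t mod q})"

end

theory Submission
  imports Defs
begin

text \<open>Write \<open>B\<close> for the average of \<open>w\<^sub>A(a) w\<^sub>B(x\<^sup>2 - a)\<close> over \<open>x\<close> and \<open>a\<close>, and \<open>\<mu>\<^sub>A\<close>, \<open>\<mu>\<^sub>B\<close> for the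
  means of the weights. For all nonnegative weights
  \<open>B + (E w\<^sub>A\<^sup>2 + E w\<^sub>B\<^sup>2) / 4 \<ge> (3 \<mu>\<^sub>A\<^sup>2 + 10 \<mu>\<^sub>A \<mu>\<^sub>B + 3 \<mu>\<^sub>B\<^sup>2) / 12\<close>; since \<open>w\<^sup>2 \<le> w\<close> for weights
  in \<open>[0, 1]\<close>, this gives \<open>B \<ge> \<epsilon> / 2\<close>, which is more than \<open>\<epsilon> / sqrt 5\<close>.

  Lifting the weights to modulus \<open>12 q\<close> does not change the averages. There, a normalised quadratic
  Gauss sum at a frequency whose order does not divide 12 has modulus at most \<open>1/2\<close>, so these
  frequencies contribute nonnegatively to the left-hand side, and the weights may be replaced by
  their averages over residue classes modulo 12. For a fixed pair of residues modulo 3, the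
  remaining form modulo 4 lives on an 8-cycle \<open>A\<^sub>0 B\<^sub>0 A\<^sub>1 B\<^sub>3 A\<^sub>2 B\<^sub>2 A\<^sub>3 B\<^sub>1\<close>, whose neighbours are the pairs
  with sum a square modulo 4, and the required bound is the copositivity of an explicit quadratic
  form in 8 variables. Summing over the pairs of residues modulo 3 costs nothing, because the
  nontrivial Gauss sums modulo 3 have normalised modulus \<open>1 / sqrt 3 < 6/10\<close>.\<close>

section \<open>A copositive form on the 8-cycle\<close>

text \<open>The right side minus the left side of \<open>cycle_ineq\<close>, with the
  \<open>a\<close>-variables at even and the \<open>b\<close>-variables at odd positions of the
  8-cycle.\<close>

definition cycle_form :: "(nat \<Rightarrow> real) \<Rightarrow> real" where
  "cycle_form x =
     12 * ((x 0)\<^sup>2 + (x 1)\<^sup>2 + (x 2)\<^sup>2 + (x 3)\<^sup>2 + (x 4)\<^sup>2 + (x 5)\<^sup>2 + (x 6)\<^sup>2 + (x 7)\<^sup>2)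
   + 24 * (x 0 * x 1 + x 1 * x 2 + x 2 * x 3 + x 3 * x 4 + x 4 * x 5 + x 5 * x 6 + x 6 * x 7 + x 7 * x 0)
   - (3 * (x 0 + x 2 + x 4 + x 6) + (x 1 + x 3 + x 5 + x 7))
     * ((x 0 + x 2 + x 4 + x 6) + 3 * (x 1 + x 3 + x 5 + x 7))"

lemma all_less_8: "(\<forall>k<8. P k) \<longleftrightarrow> P 0 \<and> P 1 \<and> P 2 \<and> P 3 \<and> P 4 \<and> P 5 \<and> P 6 \<and> P (7::nat)"
  and ex_less_8: "(\<exists>k<8. P k) \<longleftrightarrow> P 0 \<or> P 1 \<or> P 2 \<or> P 3 \<or> P 4 \<or> P 5 \<or> P 6 \<or> P (7::nat)"
proof -
  have "(k::nat) < 8 \<longleftrightarrow> k = 0 \<or> k = 1 \<or> k = 2 \<or> k = 3 \<or> k = 4 \<or> k = 5 \<or> k = 6 \<or> k = 7" for k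
    by auto
  then show "(\<forall>k<8. P k) \<longleftrightarrow> P 0 \<and> P 1 \<and> P 2 \<and> P 3 \<and> P 4 \<and> P 5 \<and> P 6 \<and> P (7::nat)"
    and "(\<exists>k<8. P k) \<longleftrightarrow> P 0 \<or> P 1 \<or> P 2 \<or> P 3 \<or> P 4 \<or> P 5 \<or> P 6 \<or> P (7::nat)"
    by auto
qed

text \<open>A rotation by one step exchanges the even sum \<open>p\<close> and the odd sum
  \<open>r\<close>, and \<open>(3 * p + r) * (p + 3 * r)\<close> is symmetric in them.\<close>

lemma cycle_form_rotate:
  shows "cycle_form (\<lambda>i. x ((i + k) mod 8)) = cycle_form x"
proof -
  have mods: "(0 + 1) mod 8 = (1::nat)" "(1 + 1) mod 8 = (2::nat)" "(2 + 1) mod 8 = (3::nat)"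
    "(3 + 1) mod 8 = (4::nat)" "(4 + 1) mod 8 = (5::nat)" "(5 + 1) mod 8 = (6::nat)"
    "(6 + 1) mod 8 = (7::nat)" "(7 + 1) mod 8 = (0::nat)"
    by simp_all
  have *: "cycle_form (\<lambda>i. x ((i + 1) mod 8)) = cycle_form x" for x
    unfolding cycle_form_def mods by algebra
  show ?thesis
  proof (induction k)
    case 0
    then show ?case by (simp add: cycle_form_def)
  next
    case (Suc k)
    then show ?case using *[of "\<lambda>i. x ((i + k) mod 8)"] by (simp add: mod_simps)
  qed
qed

lemma cycle_form_line:
  "cycle_form (\<lambda>i. x i + t * d i)
     = cycle_form x + t * (cycle_form (\<lambda>i. x i + d i) - cycle_form x - cycle_form d) + t\<^sup>2 * cycle_form d"
  unfolding cycle_form_def by algebra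

text \<open>Along a direction on which the form is nonpositive it is concave, so it can be decreased until
  a coordinate vanishes.\<close>

lemma cycle_form_shrink_support_aux:
  assumes x: "\<And>i. i < 8 \<Longrightarrow> 0 \<le> x i"
    and d: "cycle_form d \<le> 0" and slope: "cycle_form (\<lambda>i. x i + d i) - cycle_form x - cycle_form d \<le> 0"
    and supp: "\<And>i. i < 8 \<Longrightarrow> d i \<noteq> 0 \<Longrightarrow> x i \<noteq> 0"
    and neg: "\<exists>i<8. d i < 0"
  shows "\<exists>y. (\<forall>i<8. 0 \<le> y i) \<and> cycle_form y \<le> cycle_form x
           \<and> {i. i < 8 \<and> y i \<noteq> 0} \<subset> {i. i < 8 \<and> x i \<noteq> 0}"
proof -
  define N where "N = {i. i < 8 \<and> d i < 0}"
  \<comment> \<open>The first parameter at which a coordinate of \<open>x + t * d\<close> reaches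
    zero.\<close>
  define t where "t = Min ((\<lambda>i. x i / (- d i)) ` N)"
  have N: "finite N" "N \<noteq> {}" using neg by (auto simp: N_def)
  then obtain m where m: "m \<in> N" "t = x m / (- d m)"
    using Min_in[of "(\<lambda>i. x i / (- d i)) ` N"] unfolding t_def by (metis (no_types, lifting) finite_imageI image_iff image_is_empty)
  have t_le: "t \<le> x i / (- d i)" if "i \<in> N" for i
    unfolding t_def using N that by auto
  have t0: "0 \<le> t" using m x[of m] by (auto simp: N_def divide_nonneg_neg)
  define y where "y = (\<lambda>i. x i + t * d i)"
  have "0 \<le> y i" if "i < 8" for i
  proof (cases "d i < 0")
    case True
    then have "t \<le> x i / (- d i)" "0 < - d i"
      using t_le[of i] that by (auto simp: N_def)
    then have "t * (- d i) \<le> x i"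
      by (simp only: pos_le_divide_eq)
    then show ?thesis by (simp add: y_def)
  qed (use x[OF that] t0 in \<open>auto simp: y_def\<close>)
  moreover have "cycle_form y \<le> cycle_form x"
    unfolding y_def cycle_form_line
    using mult_nonneg_nonpos[OF t0 slope] mult_nonneg_nonpos[OF zero_le_power2[of t] d] by linarith
  moreover have "y m = 0" using m by (auto simp: y_def N_def)
  moreover have "y i = 0" if "x i = 0" "i < 8" for i
    using supp[of i] that by (auto simp: y_def)
  moreover have "m < 8" "x m \<noteq> 0" using m supp[of m] by (auto simp: N_def)
  ultimately show ?thesis by (intro exI[of _ y]) auto
qed

text \<open>Replacing \<open>d\<close> by \<open>- d\<close> reverses the linear term along the
  line, so one of the two directions has nonpositive slope. Since \<open>d\<close> has entries of
  both signs, either direction has a negative entry.\<close>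

lemma cycle_form_shrink_support:
  assumes x: "\<And>i. i < 8 \<Longrightarrow> 0 \<le> x i"
    and d: "cycle_form d \<le> 0"
    and supp: "\<And>i. i < 8 \<Longrightarrow> d i \<noteq> 0 \<Longrightarrow> x i \<noteq> 0"
    and neg: "\<exists>i<8. d i < 0" and pos: "\<exists>i<8. 0 < d i"
  shows "\<exists>y. (\<forall>i<8. 0 \<le> y i) \<and> cycle_form y \<le> cycle_form x
           \<and> {i. i < 8 \<and> y i \<noteq> 0} \<subset> {i. i < 8 \<and> x i \<noteq> 0}"
proof (cases "cycle_form (\<lambda>i. x i + d i) - cycle_form x - cycle_form d \<le> 0")
  case True
  then show ?thesis using cycle_form_shrink_support_aux assms by blast
next
  case False
  have "cycle_form (\<lambda>i. x i + - d i) - cycle_form x - cycle_form (\<lambda>i. - d i)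
      = - (cycle_form (\<lambda>i. x i + d i) - cycle_form x - cycle_form d)"
    and "cycle_form (\<lambda>i. - d i) = cycle_form d"
    unfolding cycle_form_def by algebra+
  with False show ?thesis
    using cycle_form_shrink_support_aux[of x "\<lambda>i. - d i"] x d supp pos by auto
qed

text \<open>Completing the square in \<open>x 0\<close> leaves a positive semidefinite form, so the
  signs of the entries do not matter here.\<close>

lemma cycle_form_nonneg_0136:
  assumes "x 2 = 0" "x 4 = 0" "x 5 = 0" "x 7 = 0"
  shows "0 \<le> cycle_form x"
proof -
  have "9 * cycle_form x = (9 * x 0 + 7 * x 1 - 5 * x 3 - 3 * x 6)\<^sup>2
      + 8 * ((3 * x 6 - x 1 - 5 / 2 * x 3)\<^sup>2 + 3 * (x 1 - x 3 / 2)\<^sup>2)"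
    unfolding cycle_form_def assms by (simp add: power2_eq_square field_simps)
  also have "\<dots> \<ge> 0" by simp
  finally show ?thesis by simp
qed

text \<open>After completing the square in \<open>x 0\<close>, the cross terms with
  \<open>x 1\<close> are nonnegative because the entries are.\<close>

lemma cycle_form_nonneg_0135:
  assumes "0 \<le> x 1" "0 \<le> x 3" "0 \<le> x 5" "x 2 = 0" "x 4 = 0" "x 6 = 0" "x 7 = 0"
  shows "0 \<le> cycle_form x"
proof -
  have "9 * cycle_form x = (9 * x 0 + 7 * x 1 - 5 * x 3 - 5 * x 5)\<^sup>2
      + 32 * (x 1)\<^sup>2 + 16 * (x 1 * x 3) + 16 * (x 1 * x 5) + 52 * (x 3 - x 5)\<^sup>2 + 4 * (x 3)\<^sup>2 + 4 * (x 5)\<^sup>2"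
    unfolding cycle_form_def assms by (simp add: power2_eq_square field_simps)
  also have "\<dots> \<ge> 0" using assms by simp
  finally show ?thesis by simp
qed

text \<open>The mirror image of \<open>cycle_form_nonneg_0135\<close> under the reflection of the
  cycle sending \<open>i\<close> to \<open>5 - i\<close> modulo 8.\<close>

lemma cycle_form_nonneg_0245:
  assumes "0 \<le> x 4" "0 \<le> x 2" "0 \<le> x 0" "x 1 = 0" "x 3 = 0" "x 6 = 0" "x 7 = 0"
  shows "0 \<le> cycle_form x"
proof -
  have "9 * cycle_form x = (9 * x 5 + 7 * x 4 - 5 * x 2 - 5 * x 0)\<^sup>2
      + 32 * (x 4)\<^sup>2 + 16 * (x 4 * x 2) + 16 * (x 4 * x 0) + 52 * (x 2 - x 0)\<^sup>2 + 4 * (x 2)\<^sup>2 + 4 * (x 0)\<^sup>2"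
    unfolding cycle_form_def assms by (simp add: power2_eq_square field_simps)
  also have "\<dots> \<ge> 0" using assms by simp
  finally show ?thesis by simp
qed

lemma cycle_form_nonneg_0246:
  assumes "x 1 = 0" "x 3 = 0" "x 5 = 0" "x 7 = 0"
  shows "0 \<le> cycle_form x"
proof -
  have "cycle_form x = 3 * ((x 0 - x 2)\<^sup>2 + (x 0 - x 4)\<^sup>2 + (x 0 - x 6)\<^sup>2
      + (x 2 - x 4)\<^sup>2 + (x 2 - x 6)\<^sup>2 + (x 4 - x 6)\<^sup>2)"
    unfolding cycle_form_def assms by (simp add: power2_eq_square field_simps)
  then show ?thesis by simp
qed

text \<open>The forbidden patterns are the supports of the directions \<open>e\<^sub>0 - e\<^sub>1 + e\<^sub>2\<close>, \<open>e\<^sub>0 - e\<^sub>1 + e\<^sub>3 - e\<^sub>4\<close> and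
  \<open>e\<^sub>0 - e\<^sub>1 - e\<^sub>4 + e\<^sub>5\<close> (up to rotation), on which the form is nonpositive.\<close>

lemma support_cases:
  fixes p :: "nat \<Rightarrow> bool"
  assumes "\<forall>k<8. \<not> (p ((0 + k) mod 8) \<and> p ((1 + k) mod 8) \<and> p ((2 + k) mod 8))"
    and "\<forall>k<8. \<not> (p ((0 + k) mod 8) \<and> p ((1 + k) mod 8) \<and> p ((3 + k) mod 8) \<and> p ((4 + k) mod 8))"
    and "\<forall>k<8. \<not> (p ((0 + k) mod 8) \<and> p ((1 + k) mod 8) \<and> p ((4 + k) mod 8) \<and> p ((5 + k) mod 8))"
  shows "\<exists>k<8. \<not> p ((7 + k) mod 8) \<and>
    (\<not> p ((2 + k) mod 8) \<and> \<not> p ((4 + k) mod 8) \<and> \<not> p ((5 + k) mod 8)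
   \<or> \<not> p ((2 + k) mod 8) \<and> \<not> p ((4 + k) mod 8) \<and> \<not> p ((6 + k) mod 8)
   \<or> \<not> p ((1 + k) mod 8) \<and> \<not> p ((3 + k) mod 8) \<and> \<not> p ((6 + k) mod 8)
   \<or> \<not> p ((1 + k) mod 8) \<and> \<not> p ((3 + k) mod 8) \<and> \<not> p ((5 + k) mod 8))"
proof -
  have mods: "(0::nat) mod 8 = 0" "1 mod 8 = (1::nat)" "2 mod 8 = (2::nat)" "3 mod 8 = (3::nat)"
    "4 mod 8 = (4::nat)" "5 mod 8 = (5::nat)" "6 mod 8 = (6::nat)" "7 mod 8 = (7::nat)" "8 mod 8 = (0::nat)"
    "9 mod 8 = (1::nat)" "10 mod 8 = (2::nat)" "11 mod 8 = (3::nat)" "12 mod 8 = (4::nat)"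
    "13 mod 8 = (5::nat)" "14 mod 8 = (6::nat)"
    by simp_all
  \<comment> \<open>With the quantifiers expanded, this is a propositional statement in the atoms
    \<open>p 0\<close> to \<open>p 7\<close>.\<close>
  show ?thesis
    using assms unfolding ex_less_8 all_less_8 add_0_left add_0_right one_add_one arith_simps numeral_plus_one one_plus_numeral mods
    by smt
qed

text \<open>Induction on the size of the support. If some rotation of the support contains that of a
  nonpositive direction with entries of both signs, it shrinks without increasing the form.
  Otherwise \<open>support_cases\<close> puts it, up to rotation, inside one of the four sets
  treated above.\<close>

lemma cycle_form_nonneg:
  assumes "\<And>i. i < 8 \<Longrightarrow> 0 \<le> x i"
  shows "0 \<le> cycle_form x"
  using assms
proof (induction "card {i. i < 8 \<and> x i \<noteq> 0}" arbitrary: x rule: less_induct)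
  case less
  let ?r = "\<lambda>k i. x ((i + k) mod 8)"
  have card_rotate: "card {i. i < 8 \<and> ?r k i \<noteq> 0} = card {i. i < 8 \<and> x i \<noteq> 0}" if "k < 8" for k
  proof (rule bij_betw_same_card[of "\<lambda>i. (i + k) mod 8"])
    have inv: "((i + k) mod 8 + (8 - k)) mod 8 = i" "((i + (8 - k)) mod 8 + k) mod 8 = i" if "i < 8" for i
      using that \<open>k < 8\<close> by (cases "i + k < 8"; simp add: mod_if)+
    show "bij_betw (\<lambda>i. (i + k) mod 8) {i. i < 8 \<and> ?r k i \<noteq> 0} {i. i < 8 \<and> x i \<noteq> 0}"
      by (rule bij_betw_byWitness[where f' = "\<lambda>i. (i + (8 - k)) mod 8"])
         (use that inv in auto)
  qed
  have rotate_pos: "0 \<le> ?r k i" for k i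
    using less.prems by simp
  show ?case
  proof (cases "\<exists>k<8. \<exists>d. cycle_form d \<le> 0 \<and> (\<forall>i<8. d i \<noteq> 0 \<longrightarrow> ?r k i \<noteq> 0) \<and> (\<exists>i<8. d i < 0) \<and> (\<exists>i<8. 0 < d i)")
    case True
    then obtain k d where "k < 8" and d: "cycle_form d \<le> 0" "\<forall>i<8. d i \<noteq> 0 \<longrightarrow> ?r k i \<noteq> 0" "\<exists>i<8. d i < 0" "\<exists>i<8. 0 < d i"
      by blast
    then obtain y where y: "\<forall>i<8. 0 \<le> y i" "cycle_form y \<le> cycle_form (?r k)"
        "{i. i < 8 \<and> y i \<noteq> 0} \<subset> {i. i < 8 \<and> ?r k i \<noteq> 0}"
      using cycle_form_shrink_support[of "?r k" d] rotate_pos by blast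
    have "card {i. i < 8 \<and> y i \<noteq> 0} < card {i. i < 8 \<and> x i \<noteq> 0}"
      using psubset_card_mono[OF _ y(3)] card_rotate[OF \<open>k < 8\<close>] by simp
    then have "0 \<le> cycle_form y" using less.hyps y(1) by blast
    then show ?thesis using y(2) cycle_form_rotate by simp
  next
    case False
    \<comment> \<open>All three directions start with 1, -1, which supplies the two signs.\<close>
    have *: False if "k < 8" "cycle_form d \<le> 0" "\<forall>i<8. d i \<noteq> 0 \<longrightarrow> ?r k i \<noteq> 0" "d 0 = 1" "d 1 = -1" for k and d :: "nat \<Rightarrow> real"
    proof -
      have "\<exists>i<8. d i < 0" "\<exists>i<8. 0 < d i"
        using that(4,5) by (auto intro: exI[of _ 0] exI[of _ 1])
      with False that show False by blast
    qed
    have b1: "\<forall>k<8. \<not> (?r k 0 \<noteq> 0 \<and> ?r k 1 \<noteq> 0 \<and> ?r k 2 \<noteq> 0)"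
      by (intro allI impI notI, rule *[of _ "(\<lambda>_. 0)(0 := 1, 1 := -1, 2 := 1)"], assumption)
         (simp_all add: cycle_form_def all_less_8 del: One_nat_def add_2_eq_Suc)
    have b2: "\<forall>k<8. \<not> (?r k 0 \<noteq> 0 \<and> ?r k 1 \<noteq> 0 \<and> ?r k 3 \<noteq> 0 \<and> ?r k 4 \<noteq> 0)"
      by (intro allI impI notI, rule *[of _ "(\<lambda>_. 0)(0 := 1, 1 := -1, 3 := 1, 4 := -1)"], assumption)
         (simp_all add: cycle_form_def all_less_8 del: One_nat_def add_2_eq_Suc)
    have b3: "\<forall>k<8. \<not> (?r k 0 \<noteq> 0 \<and> ?r k 1 \<noteq> 0 \<and> ?r k 4 \<noteq> 0 \<and> ?r k 5 \<noteq> 0)"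
      by (intro allI impI notI, rule *[of _ "(\<lambda>_. 0)(0 := 1, 1 := -1, 4 := -1, 5 := 1)"], assumption)
         (simp_all add: cycle_form_def all_less_8 del: One_nat_def add_2_eq_Suc)
    obtain k where k: "?r k 7 = 0"
        "?r k 2 = 0 \<and> ?r k 4 = 0 \<and> ?r k 5 = 0 \<or> ?r k 2 = 0 \<and> ?r k 4 = 0 \<and> ?r k 6 = 0
       \<or> ?r k 1 = 0 \<and> ?r k 3 = 0 \<and> ?r k 6 = 0 \<or> ?r k 1 = 0 \<and> ?r k 3 = 0 \<and> ?r k 5 = 0"
      using support_cases[of "\<lambda>i. x i \<noteq> 0", unfolded not_not, OF b1 b2 b3] by (elim exE conjE)
    have "0 \<le> cycle_form (?r k)"
      using k(2)
    proof (elim disjE conjE, goal_cases)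
      case 1 show ?case by (rule cycle_form_nonneg_0136) (use 1 k(1) in auto)
    next
      case 2 show ?case by (rule cycle_form_nonneg_0135) (use 2 k(1) less.prems in auto)
    next
      case 3 show ?case by (rule cycle_form_nonneg_0245) (use 3 k(1) less.prems in auto)
    next
      case 4 show ?case by (rule cycle_form_nonneg_0246) (use 4 k(1) in auto)
    qed
    then show ?thesis using cycle_form_rotate by simp
  qed
qed

lemma cycle_ineq:
  fixes a0 a1 a2 a3 b0 b1 b2 b3 :: real
  assumes "0 \<le> a0" "0 \<le> a1" "0 \<le> a2" "0 \<le> a3" "0 \<le> b0" "0 \<le> b1" "0 \<le> b2" "0 \<le> b3"
  shows "(3 * (a0 + a1 + a2 + a3) + (b0 + b1 + b2 + b3)) * ((a0 + a1 + a2 + a3) + 3 * (b0 + b1 + b2 + b3))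
    \<le> 12 * (a0\<^sup>2 + a1\<^sup>2 + a2\<^sup>2 + a3\<^sup>2) + 12 * (b0\<^sup>2 + b1\<^sup>2 + b2\<^sup>2 + b3\<^sup>2)
      + 24 * (a0 * (b0 + b1) + a1 * (b3 + b0) + a2 * (b2 + b3) + a3 * (b1 + b2))"
    (is "?l \<le> ?r")
proof -
  \<comment> \<open>In this order \<open>a\<close>i and \<open>b\<close>j are neighbours exactly
    when i + j is 0 or 1 modulo 4.\<close>
  let ?x = "(!) [a0, b0, a1, b3, a2, b2, a3, b1]"
  have "\<forall>i<8. 0 \<le> ?x i" unfolding all_less_8 using assms by simp
  then have "0 \<le> cycle_form ?x" by (intro cycle_form_nonneg) blast
  also have "cycle_form ?x = ?r - ?l"
    by (simp add: cycle_form_def) algebra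
  finally show ?thesis by simp
qed

section \<open>The inequality modulo 12\<close>

text \<open>The weights 1 and 2 count the square roots of 0 and 1 modulo 3. Constant
  \<open>a\<close> and \<open>b\<close> give equality; on the mean-zero parts the cross term has
  operator norm \<open>10 * sqrt 3 < 18\<close>. The squares below come from completing the square
  in each \<open>a i - A\<close>.\<close>

lemma ternary_ineq:
  fixes a b :: "int \<Rightarrow> real"
  shows "3 * (a 0 + a 1 + a 2)\<^sup>2 + 10 * (a 0 + a 1 + a 2) * (b 0 + b 1 + b 2) + 3 * (b 0 + b 1 + b 2)\<^sup>2
    \<le> 9 * ((a 0)\<^sup>2 + (a 1)\<^sup>2 + (a 2)\<^sup>2) + 9 * ((b 0)\<^sup>2 + (b 1)\<^sup>2 + (b 2)\<^sup>2)
      + 10 * ((a 0 * b 0 + a 1 * b 2 + a 2 * b 1) + 2 * (a 0 * b 1 + a 1 * b 0 + a 2 * b 2))"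
    (is "?l \<le> ?r")
proof -
  define A where "A = (a 0 + a 1 + a 2) / 3"
  define B where "B = (b 0 + b 1 + b 2) / 3"
  have "?r - ?l = (3 * (a 0 - A) + 5 / 3 * (b 1 - b 2))\<^sup>2 + (3 * (a 1 - A) + 5 / 3 * (b 0 - b 1))\<^sup>2
      + (3 * (a 2 - A) + 5 / 3 * (b 2 - b 0))\<^sup>2 + 2 / 3 * ((b 0 - B)\<^sup>2 + (b 1 - B)\<^sup>2 + (b 2 - B)\<^sup>2)"
    unfolding A_def B_def by (simp add: power2_eq_square field_simps)
  also have "\<dots> \<ge> 0" by simp
  finally show ?thesis by simp
qed

lemma mod_12_ineq:
  fixes \<alpha> \<beta> :: "int \<Rightarrow> real"
  assumes \<alpha>: "\<And>t. 0 \<le> \<alpha> t" and \<beta>: "\<And>t. 0 \<le> \<beta> t"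
  defines "s \<equiv> \<Sum>t=0..<12. \<alpha> t" and "s' \<equiv> \<Sum>t=0..<12. \<beta> t"
  shows "(3 * s\<^sup>2 + 10 * s * s' + 3 * s'\<^sup>2) / 12
    \<le> (\<Sum>x=0..<12. \<Sum>t=0..<12. \<alpha> t * \<beta> ((x\<^sup>2 - t) mod 12))
      + 3 * ((\<Sum>t=0..<12. (\<alpha> t)\<^sup>2) + (\<Sum>t=0..<12. (\<beta> t)\<^sup>2))"
proof -
  have I: "{0..<12::int} = {0, 1, 2, 3, 4, 5, 6, 7, 8, 9, 10, 11}"
    by (simp add: set_eq_iff) presburger
  \<comment> \<open>Chinese remainder coordinates: \<open>9 * i + 4 * r\<close> is i modulo 4 and r
    modulo 3.\<close>
  define A B where "A i r = \<alpha> ((9 * i + 4 * r) mod 12)" and "B i r = \<beta> ((9 * i + 4 * r) mod 12)" for i r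
  define a b where "a r = A 0 r + A 1 r + A 2 r + A 3 r" and "b r = B 0 r + B 1 r + B 2 r + B 3 r" for r
  define P R where "P r = (A 0 r)\<^sup>2 + (A 1 r)\<^sup>2 + (A 2 r)\<^sup>2 + (A 3 r)\<^sup>2"
    and "R r = (B 0 r)\<^sup>2 + (B 1 r)\<^sup>2 + (B 2 r)\<^sup>2 + (B 3 r)\<^sup>2" for r
  define C where "C r r' = A 0 r * (B 0 r' + B 1 r') + A 1 r * (B 3 r' + B 0 r')
      + A 2 r * (B 2 r' + B 3 r') + A 3 r * (B 1 r' + B 2 r')" for r r'
  have C: "3 * (a r)\<^sup>2 + 10 * (a r * b r') + 3 * (b r')\<^sup>2 \<le> 12 * P r + 12 * R r' + 24 * C r r'" for r r'
  proof -
    have "3 * (a r)\<^sup>2 + 10 * (a r * b r') + 3 * (b r')\<^sup>2 = (3 * a r + b r') * (a r + 3 * b r')"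
      by algebra
    also have "\<dots> \<le> 12 * P r + 12 * R r' + 24 * C r r'"
      unfolding a_def b_def P_def R_def C_def by (rule cycle_ineq) (simp_all add: A_def B_def \<alpha> \<beta>)
    finally show ?thesis .
  qed
  have s: "s = a 0 + a 1 + a 2" "s' = b 0 + b 1 + b 2"
    unfolding s_def s'_def a_def b_def A_def B_def I by simp_all
  have sq: "(\<Sum>t=0..<12. (\<alpha> t)\<^sup>2) = P 0 + P 1 + P 2" "(\<Sum>t=0..<12. (\<beta> t)\<^sup>2) = R 0 + R 1 + R 2"
    unfolding P_def R_def A_def B_def I by simp_all
  \<comment> \<open>Modulo 4 the residues 0 and 1 have two square roots each; modulo 3 they have one
    and two. Hence the factors 2 and 4.\<close>
  have conv: "(\<Sum>x=0..<12. \<Sum>t=0..<12. \<alpha> t * \<beta> ((x\<^sup>2 - t) mod 12))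
      = 2 * (C 0 0 + C 1 2 + C 2 1) + 4 * (C 0 1 + C 1 0 + C 2 2)"
    unfolding C_def A_def B_def I by (simp add: algebra_simps)
  \<comment> \<open>Taking the instances of \<open>C\<close> with r + r' = 0 modulo 3 once and those
    with r + r' = 1 twice gives every residue total weight 3, which matches
    \<open>ternary_ineq\<close>.\<close>
  show ?thesis
    using ternary_ineq[of a b] C[of 0 0] C[of 1 2] C[of 2 1] C[of 0 1] C[of 1 0] C[of 2 2]
    unfolding conv sq s by (simp add: distrib_left)
qed

section \<open>Fourier analysis on residues\<close>

lemma periodic_mod:
  fixes f :: "int \<Rightarrow> 'a"
  assumes "\<And>t. f (t + n) = f t"
  shows "f (t mod n) = f t"
proof -
  have 1: "f (t + n * int k) = f t" for t k
  proof (induction k)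
    case (Suc k)
    then show ?case using assms[of "t + n * int k"] by (simp add: algebra_simps)
  qed simp
  have "f (t mod n + n * j) = f (t mod n)" for j
  proof (cases "0 \<le> j")
    case True
    then show ?thesis using 1[of "t mod n" "nat j"] by simp
  next
    case False
    then show ?thesis using 1[of "t mod n + n * j" "nat (- j)"] by (simp add: algebra_simps)
  qed
  from this[of "t div n"] show ?thesis by simp
qed

lemma sum_periodic_shift:
  fixes f :: "int \<Rightarrow> 'a::comm_monoid_add"
  assumes "\<And>t. f (t + n) = f t" "0 < n"
  shows "(\<Sum>t=0..<n. f (t + c)) = (\<Sum>t=0..<n. f t)"
  by (rule sum.reindex_bij_witness[where i = "\<lambda>t. (t - c) mod n" and j = "\<lambda>t. (t + c) mod n"])
     (use assms(2) periodic_mod[of f, OF assms(1)] in \<open>auto simp: mod_simps\<close>)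

lemma sum_periodic_multiple:
  fixes f :: "int \<Rightarrow> 'a::real_vector"
  assumes "\<And>t. f (t + n) = f t" "0 < n" "0 \<le> m"
  shows "(\<Sum>t=0..<m * n. f t) = of_int m *\<^sub>R (\<Sum>t=0..<n. f t)"
proof -
  have "(\<Sum>t=0..<m * n. f t) = (\<Sum>(j, r)\<in>{0..<m} \<times> {0..<n}. f r)"
  proof (rule sum.reindex_bij_witness[where i = "\<lambda>(j, r). n * j + r" and j = "\<lambda>t. (t div n, t mod n)"])
    fix t assume t: "t \<in> {0..<m * n}"
    have "t div n < m"
    proof (rule ccontr)
      assume "\<not> t div n < m"
      then have "n * m \<le> n * (t div n)" using assms(2) by (intro mult_left_mono) auto
      also have "\<dots> \<le> t" using assms(2) by (simp add: minus_mod_eq_mult_div[symmetric])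
      finally show False using t by (simp add: mult.commute)
    qed
    then show "(t div n, t mod n) \<in> {0..<m} \<times> {0..<n}"
      using assms(2) t by (simp add: pos_imp_zdiv_nonneg_iff)
  next
    fix p assume "p \<in> {0..<m} \<times> {0..<n}"
    then obtain j r where p: "p = (j, r)" "0 \<le> j" "j < m" "0 \<le> r" "r < n" by auto
    have "n * j + r < n * (j + 1)" using p by (simp add: algebra_simps)
    also have "\<dots> \<le> n * m" using p assms(2) by (intro mult_left_mono) auto
    finally show "(case p of (j, r) \<Rightarrow> n * j + r) \<in> {0..<m * n}"
      using p assms(2) by (simp add: mult.commute)
  qed (use assms(2) periodic_mod[of f, OF assms(1)] in auto)
  also have "\<dots> = of_int m *\<^sub>R (\<Sum>t=0..<n. f t)"
    using assms(3) by (simp add: sum.cartesian_product[symmetric] sum_constant_scaleR)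
  finally show ?thesis .
qed

section \<open>Additive characters, the discrete Fourier transform and Gauss sums\<close>

definition unit_char :: "int \<Rightarrow> int \<Rightarrow> complex" where
  "unit_char n t = cis (2 * pi * of_int t / of_int n)"

lemma unit_char_add: "unit_char n (s + t) = unit_char n s * unit_char n t"
  by (simp add: unit_char_def cis_mult add_divide_distrib distrib_left)

lemma unit_char_0 [simp]: "unit_char n 0 = 1"
  by (simp add: unit_char_def)

lemma norm_unit_char [simp]: "norm (unit_char n t) = 1"
  by (simp add: unit_char_def)

lemma cnj_unit_char: "cnj (unit_char n t) = unit_char n (- t)"
  by (simp add: unit_char_def cis_cnj)

lemma unit_char_diff: "unit_char n (s - t) = unit_char n s * cnj (unit_char n t)"
  using unit_char_add[of n s "- t"] by (simp add: cnj_unit_char)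

lemma unit_char_eq_1_iff:
  assumes "0 < n"
  shows "unit_char n t = 1 \<longleftrightarrow> n dvd t"
proof -
  have "unit_char n t = 1 \<longleftrightarrow> cos (2 * pi * of_int t / of_int n) = 1"
    using cos_one_sin_zero by (auto simp: unit_char_def complex_eq_iff)
  also have "\<dots> \<longleftrightarrow> (\<exists>k::int. 2 * pi * of_int t / of_int n = of_int k * 2 * pi)"
    by (rule cos_one_2pi_int)
  also have "\<dots> \<longleftrightarrow> (\<exists>k::int. real_of_int t = of_int (n * k))"
    using assms by (simp add: field_simps)
  also have "\<dots> \<longleftrightarrow> (\<exists>k. t = n * k)"
    by (simp only: of_int_eq_iff)
  finally show ?thesis by (simp add: dvd_def)
qed

lemma unit_char_mult_period:
  assumes "0 < n" "n dvd s"
  shows "unit_char n (t + s) = unit_char n t"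
  using unit_char_eq_1_iff[OF assms(1)] assms(2) by (simp add: unit_char_add)

text \<open>Shifting \<open>k\<close> by one multiplies the sum by \<open>unit_char n t\<close>, so
  the sum vanishes when this factor is not 1.\<close>

lemma sum_unit_char:
  assumes "0 < n"
  shows "(\<Sum>k=0..<n. unit_char n (k * t)) = (if n dvd t then of_int n else 0)"
proof (cases "n dvd t")
  case True
  then show ?thesis
    using assms by (simp add: unit_char_eq_1_iff[THEN iffD2] of_nat_nat)
next
  case False
  have "(\<Sum>k=0..<n. unit_char n (k * t)) = (\<Sum>k=0..<n. unit_char n ((k + 1) * t))"
    by (rule sum_periodic_shift[symmetric])
       (use assms in \<open>auto simp: distrib_right unit_char_mult_period\<close>)
  also have "\<dots> = unit_char n t * (\<Sum>k=0..<n. unit_char n (k * t))"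
    by (simp add: distrib_right unit_char_add sum_distrib_left mult.commute[of "unit_char n t"])
  finally show ?thesis
    using False assms unit_char_eq_1_iff[of n t] by auto
qed

definition dft :: "int \<Rightarrow> (int \<Rightarrow> real) \<Rightarrow> int \<Rightarrow> complex" where
  "dft n u k = (\<Sum>t=0..<n. of_real (u t) * unit_char n (k * t))"

definition gauss_sum :: "int \<Rightarrow> int \<Rightarrow> complex" where
  "gauss_sum n k = (\<Sum>x=0..<n. unit_char n (k * x\<^sup>2))"

lemma parseval_dft:
  assumes "0 < n"
  shows "(\<Sum>k=0..<n. (norm (dft n u k))\<^sup>2) = of_int n * (\<Sum>t=0..<n. (u t)\<^sup>2)"
proof -
  have "complex_of_real (\<Sum>k=0..<n. (norm (dft n u k))\<^sup>2)
      = (\<Sum>k=0..<n. \<Sum>s=0..<n. \<Sum>t=0..<n. of_real (u s * u t) * unit_char n (k * (s - t)))"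
    unfolding of_real_sum complex_norm_square dft_def cnj_sum sum_product
    by (simp add: right_diff_distrib unit_char_diff mult_ac)
  also have "\<dots> = (\<Sum>s=0..<n. \<Sum>k=0..<n. \<Sum>t=0..<n. of_real (u s * u t) * unit_char n (k * (s - t)))"
    by (rule sum.swap)
  also have "\<dots> = (\<Sum>s=0..<n. \<Sum>t=0..<n. of_real (u s * u t) * (\<Sum>k=0..<n. unit_char n (k * (s - t))))"
    unfolding sum_distrib_left by (intro sum.cong refl sum.swap)
  also have "\<dots> = (\<Sum>s=0..<n. \<Sum>t=0..<n. if t = s then of_int n * of_real ((u s)\<^sup>2) else 0)"
  proof (intro sum.cong refl, goal_cases)
    case (1 s t)
    then have "n dvd s - t \<longleftrightarrow> t = s"
      by (auto simp: mod_eq_dvd_iff[symmetric])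
    then show ?case using sum_unit_char[OF assms, of "s - t"] by (simp add: power2_eq_square)
  qed
  also have "\<dots> = of_real (of_int n * (\<Sum>t=0..<n. (u t)\<^sup>2))"
    by (simp add: sum_distrib_left)
  finally show ?thesis using of_real_eq_iff by blast
qed

text \<open>Summing over \<open>k\<close> detects \<open>a + b = x\<^sup>2\<close> modulo
  \<open>n\<close>; the conjugated Gauss sum supplies the term \<open>- x\<^sup>2\<close>.\<close>

lemma sum_squares_convolution_dft:
  assumes "0 < n" and v: "\<And>t. v (t + n) = v t"
  shows "(\<Sum>k=0..<n. dft n u k * dft n v k * cnj (gauss_sum n k))
    = of_real (of_int n * (\<Sum>x=0..<n. \<Sum>a=0..<n. u a * v (x\<^sup>2 - a)))"
proof -
  have "(\<Sum>k=0..<n. dft n u k * dft n v k * cnj (gauss_sum n k))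
      = (\<Sum>k=0..<n. \<Sum>x=0..<n. \<Sum>a=0..<n. \<Sum>b=0..<n. of_real (u a * v b) * unit_char n (k * (a + b - x\<^sup>2)))"
  proof (rule sum.cong[OF refl])
    fix k
    have "dft n u k * dft n v k * cnj (gauss_sum n k)
        = (\<Sum>x=0..<n. (\<Sum>a=0..<n. \<Sum>b=0..<n. of_real (u a) * unit_char n (k * a) * (of_real (v b) * unit_char n (k * b)))
            * cnj (unit_char n (k * x\<^sup>2)))"
      unfolding dft_def sum_product by (simp only: gauss_sum_def cnj_sum sum_distrib_left)
    also have "\<dots> = (\<Sum>x=0..<n. \<Sum>a=0..<n. \<Sum>b=0..<n. of_real (u a * v b) * unit_char n (k * (a + b - x\<^sup>2)))"
      unfolding sum_distrib_right right_diff_distrib distrib_left unit_char_diff unit_char_add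
      by (intro sum.cong refl) simp
    finally show "dft n u k * dft n v k * cnj (gauss_sum n k)
        = (\<Sum>x=0..<n. \<Sum>a=0..<n. \<Sum>b=0..<n. of_real (u a * v b) * unit_char n (k * (a + b - x\<^sup>2)))" .
  qed
  also have "\<dots> = (\<Sum>x=0..<n. \<Sum>a=0..<n. \<Sum>b=0..<n. of_real (u a * v b) * (\<Sum>k=0..<n. unit_char n (k * (a + b - x\<^sup>2))))"
    unfolding sum_distrib_left
    by (subst sum.swap, rule sum.cong[OF refl], subst sum.swap, rule sum.cong[OF refl], rule sum.swap)
  also have "\<dots> = (\<Sum>x=0..<n. \<Sum>a=0..<n. \<Sum>b=0..<n. if b = (x\<^sup>2 - a) mod n then of_real (of_int n * (u a * v b)) else 0)"
  proof (intro sum.cong refl, goal_cases)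
    case (1 x a b)
    then have "n dvd a + b - x\<^sup>2 \<longleftrightarrow> b = (x\<^sup>2 - a) mod n"
      using mod_eq_dvd_iff[of b n "x\<^sup>2 - a"] by (simp add: algebra_simps)
    then show ?case using sum_unit_char[OF assms(1), of "a + b - x\<^sup>2"] by simp
  qed
  also have "\<dots> = (\<Sum>x=0..<n. \<Sum>a=0..<n. of_real (of_int n * (u a * v (x\<^sup>2 - a))))"
    using assms(1) periodic_mod[of v, OF v] by simp
  finally show ?thesis by (simp add: sum_distrib_left)
qed

text \<open>Weyl differencing: with \<open>x = h + y\<close> the phase of the squared modulus is
  linear in \<open>y\<close>, so the sum over \<open>y\<close> vanishes unless \<open>n\<close>
  divides \<open>2 * k * h\<close>. The triangle inequality bounds the rest.\<close>

lemma norm_gauss_sum_le: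
  assumes "0 < n"
  shows "(norm (gauss_sum n k))\<^sup>2 \<le> of_int n * real (card {h\<in>{0..<n}. n dvd 2 * k * h})"
proof -
  have "complex_of_real ((norm (gauss_sum n k))\<^sup>2) = (\<Sum>y=0..<n. \<Sum>x=0..<n. unit_char n (k * (x\<^sup>2 - y\<^sup>2)))"
    unfolding complex_norm_square gauss_sum_def cnj_sum sum_product
    by (subst sum.swap) (simp add: right_diff_distrib unit_char_diff)
  also have "\<dots> = (\<Sum>y=0..<n. \<Sum>h=0..<n. unit_char n (k * ((h + y)\<^sup>2 - y\<^sup>2)))"
  proof (rule sum.cong[OF refl], rule sum_periodic_shift[symmetric])
    fix x y :: int
    have "k * ((x + n)\<^sup>2 - y\<^sup>2) = k * (x\<^sup>2 - y\<^sup>2) + n * (k * (2 * x + n))" by algebra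
    then show "unit_char n (k * ((x + n)\<^sup>2 - y\<^sup>2)) = unit_char n (k * (x\<^sup>2 - y\<^sup>2))"
      by (simp add: unit_char_mult_period[OF assms])
  qed (use assms in auto)
  also have "\<dots> = (\<Sum>y=0..<n. \<Sum>h=0..<n. unit_char n (k * h\<^sup>2) * unit_char n (y * (2 * k * h)))"
    by (intro sum.cong refl) (simp add: power2_eq_square algebra_simps flip: unit_char_add)
  also have "\<dots> = (\<Sum>h=0..<n. unit_char n (k * h\<^sup>2) * (\<Sum>y=0..<n. unit_char n (y * (2 * k * h))))"
    unfolding sum_distrib_left by (rule sum.swap)
  also have "\<dots> = (\<Sum>h\<in>{h\<in>{0..<n}. n dvd 2 * k * h}. unit_char n (k * h\<^sup>2) * of_int n)"
    unfolding sum_unit_char[OF assms] by (intro sum.mono_neutral_cong_right) auto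
  finally have "norm (complex_of_real ((norm (gauss_sum n k))\<^sup>2))
      \<le> (\<Sum>h\<in>{h\<in>{0..<n}. n dvd 2 * k * h}. norm (unit_char n (k * h\<^sup>2) * of_int n))"
    by (simp only: norm_sum)
  also have "norm (complex_of_real ((norm (gauss_sum n k))\<^sup>2)) = (norm (gauss_sum n k))\<^sup>2"
    by (simp only: norm_of_real abs_power2)
  finally show ?thesis using assms by (simp add: norm_mult mult.commute)
qed

text \<open>The solutions form a subgroup modulo \<open>n\<close>, and by \<open>small\<close> its
  translates by 0, ..., \<open>d - 1\<close> are pairwise disjoint.\<close>

lemma card_dvd_mult_le:
  fixes m n d :: int
  assumes n: "0 < n" and d: "0 < d" and small: "\<And>j. 0 < j \<Longrightarrow> j < d \<Longrightarrow> \<not> n dvd m * j"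
  shows "real (card {h\<in>{0..<n}. n dvd m * h}) \<le> of_int n / of_int d"
proof -
  define H where "H = {h\<in>{0..<n}. n dvd m * h}"
  have eq: "i = i'" if "n dvd m * (i - i')" "i \<in> {0..<d}" "i' \<in> {0..<d}" for i i'
  proof (rule ccontr)
    assume "i \<noteq> i'"
    moreover have "n dvd m * (i' - i)"
      using that(1) by (metis dvd_minus_iff minus_diff_eq mult_minus_right)
    ultimately show False
      using small[of "i - i'"] small[of "i' - i"] that by (auto simp: neq_iff)
  qed
  have "inj_on (\<lambda>(h, i). (h + i) mod n) (H \<times> {0..<d})"
  proof (rule inj_onI, clarify)
    fix h i h' i' assume *: "h \<in> H" "i \<in> {0..<d}" "h' \<in> H" "i' \<in> {0..<d}" "(h + i) mod n = (h' + i') mod n"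
    have "n dvd m * ((h + i) - (h' + i'))"
      using *(5) by (simp add: mod_eq_dvd_iff)
    moreover have "n dvd m * (h' - h)"
      using * by (auto simp: H_def right_diff_distrib)
    ultimately have "n dvd m * ((h + i) - (h' + i')) + m * (h' - h)" by (rule dvd_add)
    then have "n dvd m * (i - i')" by (simp add: algebra_simps)
    with eq * have "i = i'" by blast
    moreover from this * have "h mod n = h' mod n"
      by (auto simp: mod_eq_dvd_iff)
    ultimately show "h = h' \<and> i = i'" using * by (auto simp: H_def)
  qed
  then have "card (H \<times> {0..<d}) \<le> card {0..<n}"
    by (rule card_inj_on_le) (use n in auto)
  then have "real (card H) * of_int d \<le> of_int n"
    using n d by (simp add: card_cartesian_product flip: of_nat_le_iff[where 'a = real])
  then show ?thesis using d by (simp add: H_def pos_le_divide_eq)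
qed

text \<open>This is \<open>n\<^sup>2\<close> times the sum of the average over \<open>x\<close> and
  \<open>a\<close> and a quarter of the two mean squares.\<close>

definition square_energy :: "int \<Rightarrow> (int \<Rightarrow> real) \<Rightarrow> (int \<Rightarrow> real) \<Rightarrow> real" where
  "square_energy n u v = (\<Sum>x=0..<n. \<Sum>a=0..<n. u a * v (x\<^sup>2 - a))
     + of_int n / 4 * ((\<Sum>t=0..<n. (u t)\<^sup>2) + (\<Sum>t=0..<n. (v t)\<^sup>2))"

text \<open>The energy splits over the frequencies, so each \<open>k\<close> can be estimated
  separately.\<close>

lemma square_energy_dft:
  assumes "0 < n" "\<And>t. v (t + n) = v t"
  shows "of_int n * square_energy n u v = (\<Sum>k=0..<n. Re (dft n u k * dft n v k * cnj (gauss_sum n k))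
     + of_int n / 4 * ((norm (dft n u k))\<^sup>2 + (norm (dft n v k))\<^sup>2))"
proof -
  have "(\<Sum>k=0..<n. Re (dft n u k * dft n v k * cnj (gauss_sum n k)))
      = of_int n * (\<Sum>x=0..<n. \<Sum>a=0..<n. u a * v (x\<^sup>2 - a))"
    unfolding Re_sum[symmetric] sum_squares_convolution_dft[of n v u, OF assms] by simp
  then show ?thesis
    unfolding sum.distrib sum_distrib_left[symmetric] parseval_dft[OF assms(1)] square_energy_def
    by (simp add: distrib_left)
qed

definition fold12 :: "int \<Rightarrow> (int \<Rightarrow> real) \<Rightarrow> int \<Rightarrow> real" where
  "fold12 q u t = (\<Sum>j=0..<q. u (t + 12 * j)) / of_int q"

lemma fold12_periodic:
  assumes "0 < q" "\<And>t. u (t + 12 * q) = u t"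
  shows "fold12 q u (t + 12) = fold12 q u t"
proof -
  have "(\<Sum>j=0..<q. u (t + 12 * (j + 1))) = (\<Sum>j=0..<q. u (t + 12 * j))"
    by (rule sum_periodic_shift) (use assms assms(2)[of "t + 12 * _"] in \<open>simp_all add: distrib_left flip: add.assoc\<close>)
  then show ?thesis by (simp add: fold12_def distrib_left add_ac)
qed

text \<open>Averaging over shifts by multiples of 12 keeps exactly the characters modulo
  \<open>12 * q\<close> that are trivial on 12, namely those with \<open>q dvd k\<close>.\<close>

lemma dft_fold12:
  assumes "0 < q" "\<And>t. u (t + 12 * q) = u t"
  shows "dft (12 * q) (fold12 q u) k = (if q dvd k then dft (12 * q) u k else 0)"
proof -
  let ?e = "unit_char (12 * q)"
  have q12: "0 < 12 * q" using assms(1) by simp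
  have "of_int q * dft (12 * q) (fold12 q u) k
      = (\<Sum>t=0..<12 * q. \<Sum>j=0..<q. of_real (u (t + 12 * j)) * ?e (k * t))"
    using assms(1) by (simp add: dft_def fold12_def sum_distrib_left sum_distrib_right mult_ac sum_divide_distrib)
  also have "\<dots> = (\<Sum>j=0..<q. \<Sum>t=0..<12 * q. of_real (u (t + 12 * j)) * ?e (k * t))"
    by (rule sum.swap)
  also have "\<dots> = (\<Sum>j=0..<q. \<Sum>t=0..<12 * q. of_real (u t) * ?e (k * (t - 12 * j)))"
  proof (rule sum.cong[OF refl])
    fix j
    have "(\<Sum>t=0..<12 * q. of_real (u (t + 12 * j)) * ?e (k * ((t + 12 * j) - 12 * j)))
        = (\<Sum>t=0..<12 * q. of_real (u t) * ?e (k * (t - 12 * j)))"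
    proof (rule sum_periodic_shift[OF _ q12])
      fix t
      have "k * (t + 12 * q - 12 * j) = k * (t - 12 * j) + 12 * q * k" by algebra
      then show "of_real (u (t + 12 * q)) * ?e (k * (t + 12 * q - 12 * j)) = of_real (u t) * ?e (k * (t - 12 * j))"
        by (simp add: assms(2) unit_char_mult_period[OF q12])
    qed
    then show "(\<Sum>t=0..<12 * q. of_real (u (t + 12 * j)) * ?e (k * t)) = (\<Sum>t=0..<12 * q. of_real (u t) * ?e (k * (t - 12 * j)))"
      by simp
  qed
  also have "\<dots> = dft (12 * q) u k * cnj (\<Sum>j=0..<q. ?e (12 * (j * k)))"
    unfolding dft_def cnj_sum sum_product right_diff_distrib unit_char_diff
    by (subst sum.swap) (simp add: mult_ac)
  also have "(\<Sum>j=0..<q. ?e (12 * (j * k))) = (\<Sum>j=0..<q. unit_char q (j * k))"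
    using assms(1) by (simp add: unit_char_def mult.assoc)
  finally show ?thesis
    using assms(1) by (simp add: sum_unit_char split: if_splits)
qed

text \<open>As 1, 2 and 3 divide 6, a relation \<open>12 * q dvd 2 * k * j\<close> with
  \<open>0 < j < 4\<close> would force \<open>q dvd k\<close>. So at most a quarter of the residues
  \<open>h\<close> survive in \<open>norm_gauss_sum_le\<close>, and the square root gives one
  half.\<close>

lemma norm_gauss_sum_le_half:
  assumes "0 < q" "\<not> q dvd k"
  shows "norm (gauss_sum (12 * q) k) \<le> of_int (12 * q) / 2"
proof -
  have "\<not> 12 * q dvd 2 * k * j" if "0 < j" "j < 4" for j
  proof
    assume *: "12 * q dvd 2 * k * j"
    have "j = 1 \<or> j = 2 \<or> j = 3" using that by auto
    then have e: "(6 div j) * (2 * k * j) = 12 * k" by auto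
    have "12 * q dvd 12 * k" using dvd_mult[OF *, of "6 div j"] unfolding e .
    then show False using assms(2) by simp
  qed
  then have card: "real (card {h\<in>{0..<12 * q}. 12 * q dvd 2 * k * h}) \<le> of_int (12 * q) / of_int 4"
    by (intro card_dvd_mult_le) (use assms(1) in simp_all)
  have "(norm (gauss_sum (12 * q) k))\<^sup>2
      \<le> of_int (12 * q) * real (card {h\<in>{0..<12 * q}. 12 * q dvd 2 * k * h})"
    by (rule norm_gauss_sum_le) (use assms(1) in simp)
  also have "\<dots> \<le> of_int (12 * q) * (of_int (12 * q) / of_int 4)"
    using card by (rule mult_left_mono) (use assms(1) in simp)
  also have "\<dots> = (of_int (12 * q) / 2)\<^sup>2" by (simp add: power2_eq_square)
  finally show ?thesis by (rule power2_le_imp_le) (use assms(1) in simp)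
qed

text \<open>The Gauss sums at the frequencies removed by \<^const>\<open>fold12\<close> have absolute value at most \<open>6 q\<close>,
  so by the AM-GM inequality these frequencies contribute a nonnegative amount.\<close>

lemma square_energy_fold12_le:
  assumes q: "0 < q" and u: "\<And>t. u (t + 12 * q) = u t" and v: "\<And>t. v (t + 12 * q) = v t"
  shows "square_energy (12 * q) (fold12 q u) (fold12 q v) \<le> square_energy (12 * q) u v"
proof -
  let ?n = "12 * q"
  let ?term = "\<lambda>u v k. Re (dft ?n u k * dft ?n v k * cnj (gauss_sum ?n k))
     + of_int ?n / 4 * ((norm (dft ?n u k))\<^sup>2 + (norm (dft ?n v k))\<^sup>2)"
  have n: "0 < ?n" using q by simp
  have "fold12 q v (t + ?n) = fold12 q v t" for t
    using v[of "t + 12 * _"] by (simp add: fold12_def add.assoc add.commute[of "12 * q"])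
  note folded = square_energy_dft[OF n, of "fold12 q v" "fold12 q u", OF this]
  have "?term (fold12 q u) (fold12 q v) k \<le> ?term u v k" for k
  proof (cases "q dvd k")
    case False
    have "- Re (dft ?n u k * dft ?n v k * cnj (gauss_sum ?n k)) \<le> norm (dft ?n u k * dft ?n v k * cnj (gauss_sum ?n k))"
      using complex_Re_le_cmod[of "- (dft ?n u k * dft ?n v k * cnj (gauss_sum ?n k))"] by simp
    also have "\<dots> = norm (dft ?n u k) * norm (dft ?n v k) * norm (gauss_sum ?n k)"
      by (simp add: norm_mult)
    also have "\<dots> \<le> norm (dft ?n u k) * norm (dft ?n v k) * (of_int ?n / 2)"
      by (intro mult_left_mono norm_gauss_sum_le_half q False) simp
    also have "\<dots> = of_int ?n / 4 * (2 * norm (dft ?n u k) * norm (dft ?n v k))" by simp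
    also have "\<dots> \<le> of_int ?n / 4 * ((norm (dft ?n u k))\<^sup>2 + (norm (dft ?n v k))\<^sup>2)"
      using q by (intro mult_left_mono sum_squares_bound) simp
    finally show ?thesis using False by (simp add: dft_fold12 q u v)
  qed (simp add: dft_fold12 q u v)
  then have "of_int ?n * square_energy ?n (fold12 q u) (fold12 q v) \<le> of_int ?n * square_energy ?n u v"
    unfolding folded square_energy_dft[OF n, of v u, OF v] by (rule sum_mono)
  then show ?thesis using n by simp
qed

section \<open>Reduction to modulus 12\<close>

text \<open>Serves to lift the weights from modulus \<open>q\<close> to \<open>12 * q\<close> and to
  bring the folded weights from \<open>12 * q\<close> down to 12.\<close>

lemma square_energy_multiple:
  assumes "\<And>t. u (t + n) = u t" "\<And>t. v (t + n) = v t" "0 < n" "0 \<le> m"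
  shows "square_energy (m * n) u v = (of_int m)\<^sup>2 * square_energy n u v"
proof -
  have "(\<Sum>x=0..<m * n. \<Sum>a=0..<m * n. u a * v (x\<^sup>2 - a))
      = (\<Sum>x=0..<m * n. of_int m * (\<Sum>a=0..<n. u a * v (x\<^sup>2 - a)))"
  proof (rule sum.cong[OF refl])
    fix x
    have "v (x\<^sup>2 - (t + n)) = v (x\<^sup>2 - t)" for t
      using assms(2)[of "x\<^sup>2 - (t + n)"] by simp
    then show "(\<Sum>a=0..<m * n. u a * v (x\<^sup>2 - a)) = of_int m * (\<Sum>a=0..<n. u a * v (x\<^sup>2 - a))"
      by (subst sum_periodic_multiple) (simp_all add: assms)
  qed
  also have "\<dots> = (of_int m)\<^sup>2 * (\<Sum>x=0..<n. \<Sum>a=0..<n. u a * v (x\<^sup>2 - a))"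
  proof -
    have "(\<Sum>a=0..<n. u a * v ((x + n)\<^sup>2 - a)) = (\<Sum>a=0..<n. u a * v (x\<^sup>2 - a))" for x
    proof -
      have "v ((x + n)\<^sup>2 - a) = v (x\<^sup>2 - a)" for a
      proof -
        have "((x + n)\<^sup>2 - a) mod n = (x\<^sup>2 - a) mod n"
          by (simp add: mod_eq_dvd_iff power2_eq_square algebra_simps)
        then show ?thesis using periodic_mod[of v, OF assms(2)] by metis
      qed
      then show ?thesis by simp
    qed
    then show ?thesis
      unfolding sum_distrib_left[symmetric]
      by (subst sum_periodic_multiple) (simp_all add: assms power2_eq_square)
  qed
  moreover have "(\<Sum>t=0..<m * n. (u t)\<^sup>2) = of_int m * (\<Sum>t=0..<n. (u t)\<^sup>2)"
    and "(\<Sum>t=0..<m * n. (v t)\<^sup>2) = of_int m * (\<Sum>t=0..<n. (v t)\<^sup>2)"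
    by (subst sum_periodic_multiple; simp add: assms)+
  ultimately show ?thesis
    by (simp add: square_energy_def power2_eq_square algebra_simps)
qed

lemma sum_fold12:
  assumes "0 < q" "\<And>t. u (t + 12 * q) = u t"
  shows "of_int q * (\<Sum>t=0..<12. fold12 q u t) = (\<Sum>t=0..<12 * q. u t)"
proof -
  \<comment> \<open>Folding preserves the total mass: this is frequency 0 of
    \<open>dft_fold12\<close>.\<close>
  have "complex_of_real (\<Sum>t=0..<12 * q. fold12 q u t) = complex_of_real (\<Sum>t=0..<12 * q. u t)"
    using dft_fold12[of q u 0, OF assms] by (simp add: dft_def)
  then have "(\<Sum>t=0..<12 * q. fold12 q u t) = (\<Sum>t=0..<12 * q. u t)"
    using of_real_eq_iff by blast
  moreover have "(\<Sum>t=0..<q * 12. fold12 q u t) = of_int q * (\<Sum>t=0..<12. fold12 q u t)"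
    using assms(1) fold12_periodic[of q u, OF assms] by (subst sum_periodic_multiple) auto
  ultimately show ?thesis by (simp add: mult.commute)
qed

text \<open>Lift to \<open>12 * q\<close>, fold, descend to 12 and apply \<open>mod_12_ineq\<close>.
  Lifting first avoids any assumption relating \<open>q\<close> to 12.\<close>

lemma square_energy_ge:
  assumes q: "0 < q" and u: "\<And>t. u (t + q) = u t" "\<And>t. 0 \<le> u t"
    and v: "\<And>t. v (t + q) = v t" "\<And>t. 0 \<le> v t"
  defines "s \<equiv> \<Sum>t=0..<q. u t" and "s' \<equiv> \<Sum>t=0..<q. v t"
  shows "(3 * s\<^sup>2 + 10 * s * s' + 3 * s'\<^sup>2) / 12 \<le> square_energy q u v"
proof -
  have u12: "u (t + 12 * q) = u t" and v12: "v (t + 12 * q) = v t" for t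
    using periodic_mod[of u, OF u(1)] periodic_mod[of v, OF v(1)] mod_mult_self1 by metis+
  let ?f = "fold12 q u" and ?g = "fold12 q v"
  have f: "?f (t + 12) = ?f t" "0 \<le> ?f t" and g: "?g (t + 12) = ?g t" "0 \<le> ?g t" for t
    using q u(2) v(2) fold12_periodic[of q u, OF q u12] fold12_periodic[of q v, OF q v12]
    by (auto simp: fold12_def intro!: divide_nonneg_pos sum_nonneg)
  define A B where "A = (\<Sum>t=0..<12. ?f t)" and "B = (\<Sum>t=0..<12. ?g t)"
  have "of_int q * A = 12 * s" "of_int q * B = 12 * s'"
    unfolding A_def B_def s_def s'_def sum_fold12[of q u, OF q u12] sum_fold12[of q v, OF q v12]
    using q by (simp_all add: sum_periodic_multiple u v)
  then have scaled: "144 * (3 * s\<^sup>2 + 10 * s * s' + 3 * s'\<^sup>2) = (of_int q)\<^sup>2 * (3 * A\<^sup>2 + 10 * A * B + 3 * B\<^sup>2)"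
    by algebra
  have "(3 * A\<^sup>2 + 10 * A * B + 3 * B\<^sup>2) / 12 \<le> square_energy 12 ?f ?g"
    using mod_12_ineq[of ?f ?g, OF f(2) g(2)] periodic_mod[of ?g, OF g(1)]
    by (simp add: A_def B_def square_energy_def)
  then have "(of_int q)\<^sup>2 * ((3 * A\<^sup>2 + 10 * A * B + 3 * B\<^sup>2) / 12) \<le> (of_int q)\<^sup>2 * square_energy 12 ?f ?g"
    by (rule mult_left_mono) simp
  also have "\<dots> = square_energy (12 * q) ?f ?g"
    using square_energy_multiple[of ?f 12 ?g q] f g q by (simp add: mult.commute)
  also have "\<dots> \<le> square_energy (12 * q) u v"
    using square_energy_fold12_le[of q u v] q u12 v12 by blast
  also have "\<dots> = 144 * square_energy q u v"
    using square_energy_multiple[of u q v 12] u v q by simp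
  finally show ?thesis using scaled by simp
qed

section \<open>Transfer to natural residues and conclusion\<close>

lemma sum_int_nat: "(\<Sum>t=0..<int q. f t) = (\<Sum>t<q. f (int t))"
  by (rule sum.reindex_bij_witness[where i = int and j = nat]) auto

lemma sum_zconv_fq:
  assumes "q \<ge> 1"
  shows "real q * (\<Sum>t<q. zconv q f g t * fq q t)
    = (\<Sum>x=0..<int q. \<Sum>a=0..<int q. f (nat (a mod int q)) * g (nat ((x\<^sup>2 - a) mod int q)))"
proof -
  define c where "c t = (\<Sum>a<q. f a * g ((t + q - a) mod q))" for t
  have "real q * (\<Sum>t<q. zconv q f g t * fq q t) = (\<Sum>t<q. c t * real (card {x\<in>{..<q}. x\<^sup>2 mod q = t}))"
    using assms unfolding sum_distrib_left
    by (intro sum.cong refl) (simp add: zconv_def fq_def c_def)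
  \<comment> \<open>Since \<open>fq\<close> counts square roots, the sum over \<open>t\<close>
    regroups into a sum over \<open>x\<close>.\<close>
  also have "\<dots> = (\<Sum>t<q. \<Sum>x\<in>{x\<in>{..<q}. x\<^sup>2 mod q = t}. c (x\<^sup>2 mod q))"
    by (intro sum.cong refl) simp
  also have "\<dots> = (\<Sum>x<q. c (x\<^sup>2 mod q))"
    by (rule sum.group) (use assms in auto)
  also have "\<dots> = (\<Sum>x<q. \<Sum>a<q. f (nat (int a mod int q)) * g (nat (((int x)\<^sup>2 - int a) mod int q)))"
  proof -
    \<comment> \<open>Adding \<open>q\<close> first keeps the natural subtraction from
      truncating.\<close>
    have "(x\<^sup>2 mod q + q - a) mod q = nat (((int x)\<^sup>2 - int a) mod int q)" if "a < q" for x a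
    proof -
      have "int ((x\<^sup>2 mod q + q - a) mod q) = ((int x)\<^sup>2 mod int q + int q - int a) mod int q"
        using that by (simp add: zmod_int of_nat_diff)
      also have "\<dots> = ((int x)\<^sup>2 - int a) mod int q"
        by (metis (no_types, opaque_lifting) add.commute add_diff_eq mod_add_self1 mod_diff_left_eq)
      finally show ?thesis by linarith
    qed
    then show ?thesis by (auto simp: c_def intro!: sum.cong simp flip: zmod_int)
  qed
  also have "\<dots> = (\<Sum>x=0..<int q. \<Sum>a=0..<int q. f (nat (a mod int q)) * g (nat ((x\<^sup>2 - a) mod int q)))"
    by (simp add: sum_int_nat)
  finally show ?thesis .
qed

theorem theorem3p1:
  fixes \<epsilon> :: real and q :: nat and wA wB :: "nat \<Rightarrow> real"
  assumes "\<epsilon> > 0" and "q \<ge> 1"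
    and "\<And>t. t < q \<Longrightarrow> 0 \<le> wA t \<and> wA t \<le> 1"
    and "\<And>t. t < q \<Longrightarrow> 0 \<le> wB t \<and> wB t \<le> 1"
    and "(\<Sum>t<q. wA t) \<ge> (3/8 + \<epsilon>) * real q"
    and "(\<Sum>t<q. wB t) \<ge> (3/8 + \<epsilon>) * real q"
  shows "(\<Sum>t<q. zconv q wA wB t * fq q t) \<ge> (\<epsilon> / sqrt 5) * real q"
proof -
  define u v where "u t = wA (nat (t mod int q))" and "v t = wB (nat (t mod int q))" for t
  define s s' where "s = (\<Sum>t<q. wA t)" and "s' = (\<Sum>t<q. wB t)"
  define S where "S = (\<Sum>t<q. zconv q wA wB t * fq q t)"
  have q: "0 < int q" "0 < real q" using assms(2) by auto
  have bounds: "0 \<le> u t" "u t \<le> 1" "0 \<le> v t" "v t \<le> 1" for t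
    using assms(3,4) q by (auto simp: u_def v_def nat_less_iff)
  have sums: "(\<Sum>t=0..<int q. u t) = s" "(\<Sum>t=0..<int q. v t) = s'"
    unfolding sum_int_nat s_def s'_def by (auto simp: u_def v_def intro!: sum.cong)
  \<comment> \<open>Here the upper bound 1 on the weights enters, through
    \<open>w\<^sup>2 \<le> w\<close>.\<close>
  have squares: "(\<Sum>t=0..<int q. (u t)\<^sup>2) \<le> s" "(\<Sum>t=0..<int q. (v t)\<^sup>2) \<le> s'"
    unfolding sums[symmetric] using bounds
    by (auto intro!: sum_mono simp: power2_eq_square mult_left_le)
  have "(3 * s\<^sup>2 + 10 * s * s' + 3 * s'\<^sup>2) / 12 \<le> square_energy (int q) u v"
    using square_energy_ge[of "int q" u v] q bounds sums by (simp add: u_def v_def)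
  also have "\<dots> \<le> real q * S + real q / 4 * (s + s')"
    using squares q sum_zconv_fq[OF assms(2), of wA wB]
    by (simp add: square_energy_def S_def u_def v_def mult_left_mono)
  finally have main: "(3 * s\<^sup>2 + 10 * s * s' + 3 * s'\<^sup>2) / 12 \<le> real q * S + real q / 4 * (s + s')" .
  \<comment> \<open>The excesses of the two means over their lower bound.\<close>
  define x y where "x = s / real q - (3/8 + \<epsilon>)" and "y = s' / real q - (3/8 + \<epsilon>)"
  have xy: "0 \<le> x" "0 \<le> y"
    using assms(5,6) q by (simp_all add: x_def y_def s_def s'_def pos_le_divide_eq)
  have ss: "s = real q * (3/8 + \<epsilon> + x)" "s' = real q * (3/8 + \<epsilon> + y)"
    using q by (simp_all add: x_def y_def)
  have "real q * (real q * (\<epsilon> / 2)) \<le> real q * S"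
  proof -
    \<comment> \<open>For equal means m the bound is \<open>4/3 * m\<^sup>2 - m/2\<close>, which
      vanishes at 3/8 with slope 1/2. This explains both the threshold and
      \<open>\<epsilon> / 2\<close>; the remainder has only nonnegative terms.\<close>
    have "(3 * s\<^sup>2 + 10 * s * s' + 3 * s'\<^sup>2) / 12 - real q / 4 * (s + s') - real q * (real q * (\<epsilon> / 2))
      = (real q)\<^sup>2 * (4 / 3 * \<epsilon>\<^sup>2 + (1/4 + 4/3 * \<epsilon>) * (x + y) + (3 * x\<^sup>2 + 10 * x * y + 3 * y\<^sup>2) / 12)"
      unfolding ss by (simp add: power2_eq_square field_simps)
    also have "\<dots> \<ge> 0" using xy assms(1) by simp
    finally show ?thesis using main by linarith
  qed
  then have "real q * (\<epsilon> / 2) \<le> S" using q by simp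
  moreover have "\<epsilon> / sqrt 5 \<le> \<epsilon> / 2"
    using assms(1) by (intro divide_left_mono) (auto simp: real_le_rsqrt)
  then have "\<epsilon> / sqrt 5 * real q \<le> \<epsilon> / 2 * real q"
    by (rule mult_right_mono) simp
  ultimately show ?thesis unfolding S_def by (simp add: mult.commute)
qed

end
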